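(* Let $V$ be a module over the linear space $W$ admitting a $\star$-multiplicative basis $\mathfrak{B}=\{v_i\}_{i\in I}$ respect to a fixed basis $\mathfrak{B}'=\{w_j\}_{j\in J}$ of $W$. Then $V=\bigoplus_k V_k$ is the direct sum of the family $\{V_k\}_k$ of its minimal submodules, each one admitting a $\star$-multiplicative basis inherited from $\mathfrak{B}$.
   Context: $\mathbb{F}$ is an arbitrary field; $V$ and $W$ are $\mathbb{F}$-linear spaces of arbitrary (possibly infinite) dimension. $V$ is a module over the linear space $W$ if it is endowed with a bilinear map $V\times W\to V$, $(v,w)\mapsto vw$ (no further axioms). A submodule of $V$ is a linear subspace $Y\subset V$ with $YW\subset Y$. Given a basis $\mathfrak{B}'=\{w_j\}_{j\in J}$ of $W$, a basis $\mathfrak{B}=\{v_i\}_{i\in I}$ of $V$ is multiplicative respect to $\mathfrak{B}'$ if for any $i\in I$, $j\in J$ either $v_iw_j=0$ or $0\neq v_iw_j\in\mathbb{F}v_k$ for some (unique) $k\in I$. A submodule $Y\subset V$ admits a ($\star$-)multiplicative basis $\mathfrak{B}_Y$ inherited from $\mathfrak{B}$ if $\mathfrak{B}_Y$ is a ($\star$-)multiplicative basis of $Y$ with $\mathfrak{B}_Y\subset\mathfrak{B}$. A module $V$ admitting a multiplicative basis $\mathfrak{B}$ respect to a fixed basis of $W$ is minimal if its unique nonzero submodule admitting a multiplicative basis inherited from $\mathfrak{B}$ is $V$ (so a minimal module is nonzero). A minimal submodule of $V$ is a submodule $Y$ admitting a multiplicative basis $\mathfrak{B}_Y$ inherited from $\mathfrak{B}$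 and which is minimal as a module over $W$ with the basis $\mathfrak{B}_Y$. For each $j\in J$ introduce a new symbol $\overline{j}\notin J$ and put $\overline{J}:=\{\overline{j}: j\in J\}$. Let $\mathcal{P}(I)$ be the power set of $I$. Define $\star: I\times(J\,\dot\cup\,\overline{J})\to\mathcal{P}(I)$ as follows: for $i\in I$, $j\in J$, $i\star j:=\emptyset$ if $v_iw_j=0$, and $i\star j:=\{k\}$ if $0\neq v_iw_j\in\mathbb{F}v_k$; for $i\in I$, $\overline{j}\in\overline{J}$, $i\star\overline{j}:=\{k\in I: 0\neq v_kw_j\in\mathbb{F}v_i\}$. The basis $\mathfrak{B}$ is $\star$-multiplicative respect to $\mathfrak{B}'$ if it is multiplicative respect to $\mathfrak{B}'$ and, whenever $a,b\in I$ satisfy $b\in a\star j$ for some $j\in J\,\dot\cup\,\overline{J}$, then $v_b\in v_aW$, where $v_aW=\{v_aw: w\in W\}$. For a submodule $Y$ with inherited basis $\mathfrak{B}_Y=\{v_i\}_{i\in I_Y}$, $I_Y\subset I$, this notion is applied to the module $Y$ over $W$, with index set $I_Y$ in place of $I$. *)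

theory Defs
  imports Complex_Main
begin

definition (in vector_space) direct_sum_of :: "'b set set \<Rightarrow> bool"
  where "direct_sum_of \<V> \<longleftrightarrow>
    (\<forall>Y\<in>\<V>. subspace Y) \<and>
    (\<forall>x. \<exists>!f. (\<forall>Y\<in>\<V>. f Y \<in> Y) \<and> (\<forall>Y. Y \<notin> \<V> \<longrightarrow> f Y = 0) \<and>
              finite {Y. f Y \<noteq> 0} \<and> x = (\<Sum>Y | f Y \<noteq> 0. f Y))"

text \<open>
  A module \<open>V\<close> over a linear space \<open>W\<close>, together with a fixed basis \<open>(w j)\<close>, \<open>j \<in> J\<close>, of \<open>W\<close>.
  The spaces \<open>V\<close> and \<open>W\<close> are the types \<open>'v\<close> and \<open>'w\<close>. No axiom beyond bilinearity is imposed on the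
  action.
\<close>

locale based_module =
  V: vector_space scaleV + W: vector_space scaleW
  for scaleV :: "'f::field \<Rightarrow> 'v::ab_group_add \<Rightarrow> 'v"
    and scaleW :: "'f \<Rightarrow> 'w::ab_group_add \<Rightarrow> 'w" +
  fixes act :: "'v \<Rightarrow> 'w \<Rightarrow> 'v"  (infixl \<open>\<cdot>\<close> 70)
    and w :: "'j \<Rightarrow> 'w"
    and J :: "'j set"
  assumes act_linear_left: "Vector_Spaces.linear scaleV scaleV (\<lambda>x. x \<cdot> y)"
    and act_linear_right: "Vector_Spaces.linear scaleW scaleV (\<lambda>y. x \<cdot> y)"
    and w_inj: "inj_on w J"
    and w_independent: "W.independent (w ` J)"
    and w_span: "W.span (w ` J) = UNIV"
begin

definition submodule :: "'v set \<Rightarrow> bool"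
  where "submodule Y \<longleftrightarrow> V.subspace Y \<and> (\<forall>y\<in>Y. \<forall>x. y \<cdot> x \<in> Y)"

definition line :: "'v \<Rightarrow> 'v set"
  where "line x = range (\<lambda>c. scaleV c x)"

definition family_basis :: "'v set \<Rightarrow> ('i \<Rightarrow> 'v) \<Rightarrow> 'i set \<Rightarrow> bool"
  where "family_basis Y v I \<longleftrightarrow> inj_on v I \<and> V.independent (v ` I) \<and> V.span (v ` I) = Y"

definition multiplicative_basis :: "'v set \<Rightarrow> ('i \<Rightarrow> 'v) \<Rightarrow> 'i set \<Rightarrow> bool"
  where "multiplicative_basis Y v I \<longleftrightarrow>
    family_basis Y v I \<and>
    (\<forall>i\<in>I. \<forall>j\<in>J. v i \<cdot> w j = 0 \<or> (\<exists>k\<in>I. v i \<cdot> w j \<noteq> 0 \<and> v i \<cdot> w j \<in> line (v k)))"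

text \<open>
  The operation \<open>\<star>\<close> relative to an index set \<open>I\<close>. The disjoint union of \<open>J\<close> and its copy of barred
  symbols is \<open>J <+> J\<close>: \<open>Inl j\<close> is \<open>j\<close> and \<open>Inr j\<close> is the barred \<open>j\<close>. For a multiplicative basis the
  set in the second branch of the first equation is a singleton, see \<open>star_Inl_singleton\<close>.
\<close>

fun star :: "('i \<Rightarrow> 'v) \<Rightarrow> 'i set \<Rightarrow> 'i \<Rightarrow> 'j + 'j \<Rightarrow> 'i set"
  where
    "star v I i (Inl j) = (if v i \<cdot> w j = 0 then {} else {k\<in>I. v i \<cdot> w j \<in> line (v k)})"
  | "star v I i (Inr j) = {k\<in>I. v k \<cdot> w j \<noteq> 0 \<and> v k \<cdot> w j \<in> line (v i)}"

definition star_multiplicative_basis :: "'v set \<Rightarrow> ('i \<Rightarrow> 'v) \<Rightarrow> 'i set \<Rightarrow> bool"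
  where "star_multiplicative_basis Y v I \<longleftrightarrow>
    multiplicative_basis Y v I \<and>
    (\<forall>a\<in>I. \<forall>b\<in>I. (\<exists>j\<in>J <+> J. b \<in> star v I a j) \<longrightarrow> v b \<in> range (\<lambda>x. v a \<cdot> x))"

definition inherits_multiplicative_basis :: "'v set \<Rightarrow> ('i \<Rightarrow> 'v) \<Rightarrow> 'i set \<Rightarrow> bool"
  where "inherits_multiplicative_basis Y v I \<longleftrightarrow> (\<exists>K\<subseteq>I. multiplicative_basis Y v K)"

definition inherits_star_multiplicative_basis :: "'v set \<Rightarrow> ('i \<Rightarrow> 'v) \<Rightarrow> 'i set \<Rightarrow> bool"
  where "inherits_star_multiplicative_basis Y v I \<longleftrightarrow> (\<exists>K\<subseteq>I. star_multiplicative_basis Y v K)"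

text \<open>
  The equivalence below also forces \<open>Y\<close> itself to be a nonzero submodule.
\<close>

definition minimal_module :: "'v set \<Rightarrow> ('i \<Rightarrow> 'v) \<Rightarrow> 'i set \<Rightarrow> bool"
  where "minimal_module Y v I \<longleftrightarrow>
    multiplicative_basis Y v I \<and>
    (\<forall>Z. Z \<subseteq> Y \<and> submodule Z \<and> Z \<noteq> {0} \<and> inherits_multiplicative_basis Z v I \<longleftrightarrow> Z = Y)"

definition minimal_submodules :: "('i \<Rightarrow> 'v) \<Rightarrow> 'i set \<Rightarrow> 'v set set"
  where "minimal_submodules v I =
    {Y. submodule Y \<and> (\<exists>K\<subseteq>I. multiplicative_basis Y v K \<and> minimal_module Y v K)}"

lemma star_Inl_singleton:
  assumes "multiplicative_basis Y v I" "i \<in> I" "j \<in> J" "k \<in> I"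
    and "v i \<cdot> w j \<noteq> 0" "v i \<cdot> w j \<in> line (v k)"
  shows "star v I i (Inl j) = {k}"
proof -
  have ind: "V.independent (v ` I)" and inj: "inj_on v I"
    using assms(1) by (auto simp: multiplicative_basis_def family_basis_def)
  have "l = k" if l: "l \<in> I" "v i \<cdot> w j \<in> line (v l)" for l
  proof (rule ccontr)
    assume "l \<noteq> k"
    then have ne: "v l \<noteq> v k"
      using inj l(1) assms(4) by (auto dest: inj_onD)
    obtain c d where c: "v i \<cdot> w j = scaleV c (v k)" and d: "v i \<cdot> w j = scaleV d (v l)"
      using assms(6) l(2) by (auto simp: line_def)
    have "c \<noteq> 0" using c assms(5) by auto
    have "scaleV (inverse c) (scaleV c (v k)) = scaleV (inverse c) (scaleV d (v l))"
      using c d by simp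
    then have "v k = scaleV (inverse c * d) (v l)"
      using \<open>c \<noteq> 0\<close> by simp
    moreover have "scaleV (inverse c * d) (v l) \<in> V.span {v l}"
      by (intro V.span_scale V.span_base singletonI)
    ultimately have "v k \<in> V.span {v l}" by (rule ssubst)
    moreover have "{v l} \<subseteq> v ` I - {v k}" using ne l(1) by auto
    ultimately have "v k \<in> V.span (v ` I - {v k})"
      using V.span_mono[of "{v l}" "v ` I - {v k}"] by (rule_tac subsetD)
    then show False
      using ind assms(4) by (auto simp: V.dependent_def)
  qed
  then have "{l\<in>I. v i \<cdot> w j \<in> line (v l)} = {k}"
    using assms(4,6) by blast
  then show ?thesis
    using assms(5) by simp
qed

end

end

theory Submission
  imports Defs
begin

text \<open>
  Draw an arrow from \<open>i\<close> to \<open>k\<close> when some \<open>v i \<cdot> w j\<close> is a nonzero multiple of \<open>v k\<close>. Because the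
  \<open>v i\<close> are independent, a subset \<open>L\<close> of \<open>I\<close> spans a submodule on which \<open>v\<close> is again multiplicative
  exactly when no arrow leaves \<open>L\<close> (\<open>multiplicative_basis_subfamily_iff\<close>). Studying submodules with
  an inherited basis is therefore the same as studying arrow-closed index sets.

  The \<open>\<star>\<close>-condition makes arrows reversible (\<open>arrow_sym\<close>): an arrow from \<open>i\<close> to \<open>k\<close> forces
  \<open>v i\<close> to lie in \<open>v k \<cdot> W\<close>, hence in the span of the products \<open>v k \<cdot> w j\<close>; each of those is a
  multiple of a basis vector, and independence makes \<open>v i\<close> one of these basis vectors. So
  reachability along arrows is an equivalence relation on \<open>I\<close>. Its classes are the minimal nonempty
  arrow-closed sets, so their spans are exactly the minimal submodules
  (\<open>minimal_submodules_eq_component_spans\<close>). As the classes partition a basis of \<open>V\<close>, their spans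
  have direct sum \<open>V\<close> (\<open>direct_sum_of_basis_blocks\<close>).
\<close>

section \<open>Direct sums from a partitioned basis\<close>

text \<open>
  The component of \<open>x\<close> in a block \<open>Y\<close> is the part of its basis expansion that is supported in \<open>Y\<close>.
  It is the only choice: the coordinate of \<open>x\<close> at \<open>b\<close> can only come from the summand in the block
  that contains \<open>b\<close>.
\<close>

lemma (in vector_space) direct_sum_of_basis_blocks:
  assumes ind: "independent B" and span: "span B = UNIV"
    and block: "\<And>Y. Y \<in> \<V> \<Longrightarrow> span (B \<inter> Y) = Y"
    and partition: "\<And>b. b \<in> B \<Longrightarrow> \<exists>!Y. Y \<in> \<V> \<and> b \<in> Y"
  shows "direct_sum_of \<V>"
  unfolding direct_sum_of_def
proof (intro conjI ballI allI)
  show "subspace Y" if "Y \<in> \<V>" for Y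
    using block[OF that] subspace_span by metis
next
  fix x
  let ?decomp = "\<lambda>f. (\<forall>Y\<in>\<V>. f Y \<in> Y) \<and> (\<forall>Y. Y \<notin> \<V> \<longrightarrow> f Y = 0) \<and>
                     finite {Y. f Y \<noteq> 0} \<and> x = (\<Sum>Y | f Y \<noteq> 0. f Y)"
  let ?r = "representation B"
  obtain block_of where block_of: "\<And>b. b \<in> B \<Longrightarrow> block_of b \<in> \<V> \<and> b \<in> block_of b"
    using partition by metis
  have block_of_eq: "Y = block_of b" if "Y \<in> \<V>" "b \<in> B" "b \<in> Y" for Y b
    using partition[of b] block_of[of b] that by blast
  show "\<exists>!f. ?decomp f"
  proof (rule ex_ex1I)
    define S where "S = {b. ?r x b \<noteq> 0}"
    define f where "f Y = (if Y \<in> \<V> then \<Sum>b | b \<in> S \<and> block_of b = Y. ?r x b *s b else 0)" for Y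
    have S: "finite S" "S \<subseteq> B"
      using finite_representation representation_ne_zero by (auto simp: S_def)
    have supp: "{Y. f Y \<noteq> 0} \<subseteq> block_of ` S"
    proof
      fix Y assume "Y \<in> {Y. f Y \<noteq> 0}"
      then have "(\<Sum>b | b \<in> S \<and> block_of b = Y. ?r x b *s b) \<noteq> 0"
        by (auto simp: f_def split: if_splits)
      then have "\<exists>b. b \<in> S \<and> block_of b = Y"
        by (blast elim: sum.not_neutral_contains_not_neutral)
      then show "Y \<in> block_of ` S" by blast
    qed
    have "(\<Sum>Y | f Y \<noteq> 0. f Y) = (\<Sum>Y\<in>block_of ` S. f Y)"
      using supp S(1) by (intro sum.mono_neutral_left) auto
    also have "\<dots> = (\<Sum>Y\<in>block_of ` S. \<Sum>b | b \<in> S \<and> block_of b = Y. ?r x b *s b)"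
      using S(2) block_of by (intro sum.cong) (auto simp: f_def)
    also have "\<dots> = (\<Sum>b\<in>S. ?r x b *s b)"
      using S(1) by (intro sum.group) auto
    also have "\<dots> = x"
      unfolding S_def using ind span by (intro sum_nonzero_representation_eq) auto
    finally have "x = (\<Sum>Y | f Y \<noteq> 0. f Y)" by simp
    moreover have "f Y \<in> Y" if "Y \<in> \<V>" for Y
    proof -
      have "(\<Sum>b | b \<in> S \<and> block_of b = Y. ?r x b *s b) \<in> span (B \<inter> Y)"
        using S(2) block_of by (intro span_sum span_scale span_base) auto
      then show ?thesis
        using that block[OF that] by (simp add: f_def)
    qed
    moreover have "finite {Y. f Y \<noteq> 0}"
      using supp S(1) by (meson finite_imageI finite_subset)
    ultimately show "\<exists>f. ?decomp f"
      by (intro exI[of _ f]) (simp add: f_def)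
  next
    have coordinate: "?r (f (block_of b)) b = ?r x b" if f: "?decomp f" and b: "b \<in> B" for f b
    proof -
      have other: "?r (f Y) b = 0" if "Y \<noteq> block_of b" for Y
      proof (cases "Y \<in> \<V>")
        case True
        have "?r (f Y) = representation (B \<inter> Y) (f Y)"
          using block[OF True] f True ind
          by (intro representation_extend) auto
        moreover have "b \<notin> Y" using block_of_eq True b that by blast
        ultimately show ?thesis
          using representation_ne_zero[of "B \<inter> Y" "f Y" b] by auto
      next
        case False
        then show ?thesis using f by (simp add: representation_zero)
      qed
      have "?r x b = ?r (\<Sum>Y | f Y \<noteq> 0. f Y) b"
        using f by simp
      also have "\<dots> = (\<Sum>Y | f Y \<noteq> 0. ?r (f Y) b)"
        using ind span by (subst representation_sum) auto
      also have "\<dots> = (\<Sum>Y\<in>insert (block_of b) {Y. f Y \<noteq> 0}. ?r (f Y) b)"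
        using f by (intro sum.mono_neutral_left) (auto simp: representation_zero)
      also have "\<dots> = (\<Sum>Y\<in>{block_of b}. ?r (f Y) b)"
        using f other by (intro sum.mono_neutral_right) auto
      finally show ?thesis by simp
    qed
    fix f g assume fg: "?decomp f" "?decomp g"
    show "f = g"
    proof
      fix Y
      show "f Y = g Y"
      proof (cases "Y \<in> \<V>")
        case True
        have restrict: "?r (h Y) = representation (B \<inter> Y) (h Y)" if "?decomp h" for h
          using block[OF True] that True ind by (intro representation_extend) auto
        have "?r (f Y) b = ?r (g Y) b" for b
        proof (cases "b \<in> B \<inter> Y")
          case b: True
          then show ?thesis
            using coordinate[OF fg(1), of b] coordinate[OF fg(2), of b] block_of_eq[OF True, of b]
            by auto
        next
          case False
          then show ?thesis
            using restrict[OF fg(1)] restrict[OF fg(2)] representation_ne_zero[of "B \<inter> Y" _ b]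
            by metis
        qed
        then have "?r (f Y) = ?r (g Y)" by blast
        moreover have "(\<Sum>b | ?r y b \<noteq> 0. ?r y b *s b) = y" for y
          using ind span by (intro sum_nonzero_representation_eq) auto
        ultimately show ?thesis by metis
      next
        case False
        then show ?thesis using fg by simp
      qed
    qed
  qed
qed

section \<open>Spans and submodules\<close>

context based_module
begin

lemma act_mem_span_basis_products: "x \<cdot> y \<in> V.span ((\<lambda>j. x \<cdot> w j) ` J)"
proof -
  interpret right: Vector_Spaces.linear scaleW scaleV "\<lambda>y. x \<cdot> y"
    by (rule act_linear_right)
  have "x \<cdot> y \<in> (\<lambda>y. x \<cdot> y) ` W.span (w ` J)"
    using w_span by simp
  also have "\<dots> = V.span ((\<lambda>y. x \<cdot> y) ` w ` J)"
    by (rule right.span_image[symmetric])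
  finally show ?thesis by (simp add: image_image)
qed

lemma submodule_span:
  assumes "\<And>s j. s \<in> S \<Longrightarrow> j \<in> J \<Longrightarrow> s \<cdot> w j \<in> V.span S"
  shows "submodule (V.span S)"
  unfolding submodule_def
proof (intro conjI ballI allI)
  fix y x assume "y \<in> V.span S"
  interpret left: Vector_Spaces.linear scaleV scaleV "\<lambda>y. y \<cdot> x"
    by (rule act_linear_left)
  have "s \<cdot> x \<in> V.span S" if "s \<in> S" for s
  proof -
    have "V.span ((\<lambda>j. s \<cdot> w j) ` J) \<subseteq> V.span S"
      using assms that by (intro V.span_minimal) auto
    then show ?thesis using act_mem_span_basis_products by blast
  qed
  then have "V.span ((\<lambda>s. s \<cdot> x) ` S) \<subseteq> V.span S"
    by (intro V.span_minimal) auto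
  moreover have "y \<cdot> x \<in> V.span ((\<lambda>s. s \<cdot> x) ` S)"
    unfolding left.span_image using \<open>y \<in> V.span S\<close> by (rule imageI)
  ultimately show "y \<cdot> x \<in> V.span S" by blast
qed (rule V.subspace_span)

lemma mem_line_swap:
  assumes "x \<noteq> 0" "x \<in> line y"
  shows "y \<in> line x"
proof -
  obtain c where "x = scaleV c y"
    using assms(2) by (auto simp: line_def)
  moreover from this have "c \<noteq> 0" using assms(1) by auto
  ultimately have "y = scaleV (inverse c) x" by simp
  then show ?thesis by (auto simp: line_def)
qed

lemma line_subset_span: "x \<in> V.span S \<Longrightarrow> line x \<subseteq> V.span S"
  unfolding line_def using V.span_scale by blast

lemma family_basis_mem_span_iff:
  assumes "family_basis Y v I" "L \<subseteq> I" "i \<in> I"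
  shows "v i \<in> V.span (v ` L) \<longleftrightarrow> i \<in> L"
proof
  assume span: "v i \<in> V.span (v ` L)"
  show "i \<in> L"
  proof (rule ccontr)
    assume "i \<notin> L"
    then have "v ` L \<subseteq> v ` I - {v i}"
      using assms by (auto simp: family_basis_def dest: inj_onD)
    then have "v i \<in> V.span (v ` I - {v i})"
      using span V.span_mono by blast
    then show False
      using assms by (auto simp: family_basis_def V.dependent_def)
  qed
qed (simp add: V.span_base)

lemma family_basis_subfamily:
  assumes "family_basis Y v I" "L \<subseteq> I"
  shows "family_basis (V.span (v ` L)) v L"
  unfolding family_basis_def
proof (intro conjI)
  show "inj_on v L"
    using assms inj_on_subset unfolding family_basis_def by blast
  show "V.independent (v ` L)"
    using assms V.independent_mono[OF _ image_mono] unfolding family_basis_def by blast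
qed (rule refl)

section \<open>Arrows between indices\<close>

text \<open>
  For \<open>i\<close> and \<open>k\<close> in \<open>I\<close>, an arrow from \<open>i\<close> to \<open>k\<close> says that \<open>k \<in> star v I i (Inl j)\<close>, equivalently
  \<open>i \<in> star v I k (Inr j)\<close>, for some \<open>j \<in> J\<close>.
\<close>

definition arrow :: "('i \<Rightarrow> 'v) \<Rightarrow> 'i set \<Rightarrow> 'i \<Rightarrow> 'i \<Rightarrow> bool"
  where "arrow v I i k \<longleftrightarrow> i \<in> I \<and> k \<in> I \<and> (\<exists>j\<in>J. v i \<cdot> w j \<noteq> 0 \<and> v i \<cdot> w j \<in> line (v k))"

definition arrow_closed :: "('i \<Rightarrow> 'v) \<Rightarrow> 'i set \<Rightarrow> 'i set \<Rightarrow> bool"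
  where "arrow_closed v I L \<longleftrightarrow> (\<forall>i\<in>L. \<forall>k. arrow v I i k \<longrightarrow> k \<in> L)"

definition component :: "('i \<Rightarrow> 'v) \<Rightarrow> 'i set \<Rightarrow> 'i \<Rightarrow> 'i set"
  where "component v I i = {k. (arrow v I)\<^sup>*\<^sup>* i k}"

lemma component_self: "i \<in> component v I i"
  by (simp add: component_def)

lemma arrow_closed_component: "arrow_closed v I (component v I i)"
  unfolding arrow_closed_def component_def by (blast intro: rtranclp.rtrancl_into_rtrancl)

lemma component_subset_arrow_closed:
  assumes "arrow_closed v I L" "i \<in> L"
  shows "component v I i \<subseteq> L"
proof
  fix k assume "k \<in> component v I i"
  then have "(arrow v I)\<^sup>*\<^sup>* i k" by (simp add: component_def)
  then show "k \<in> L"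
    by induction (use assms in \<open>auto simp: arrow_closed_def\<close>)
qed

lemma component_subset: "i \<in> I \<Longrightarrow> component v I i \<subseteq> I"
  by (intro component_subset_arrow_closed) (auto simp: arrow_closed_def arrow_def)

text \<open>
  If \<open>L\<close> indexes a multiplicative basis of \<open>Y\<close>, a nonzero product \<open>v i \<cdot> w j\<close> with \<open>i \<in> L\<close> stays in
  the span of \<open>v ` L\<close>. If the product is a multiple of \<open>v k\<close>, then \<open>v k\<close> lies in that span too, and
  independence puts \<open>k\<close> into \<open>L\<close>. Conversely, an arrow-closed \<open>L\<close> contains the target index of every
  nonzero product.
\<close>

lemma multiplicative_basis_subfamily_iff:
  assumes mult: "multiplicative_basis UNIV v I" and "L \<subseteq> I"
  shows "multiplicative_basis Y v L \<longleftrightarrow> Y = V.span (v ` L) \<and> arrow_closed v I L"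
proof
  assume Y: "multiplicative_basis Y v L"
  have "k \<in> L" if i: "i \<in> L" and k: "arrow v I i k" for i k
  proof -
    obtain j where j: "j \<in> J" "v i \<cdot> w j \<noteq> 0" "v i \<cdot> w j \<in> line (v k)"
      using k by (auto simp: arrow_def)
    then obtain l where l: "l \<in> L" "v i \<cdot> w j \<in> line (v l)"
      using Y i by (auto simp: multiplicative_basis_def)
    have "v i \<cdot> w j \<in> V.span (v ` L)"
      using l line_subset_span V.span_base by blast
    then have "v k \<in> V.span (v ` L)"
      using j mem_line_swap line_subset_span by blast
    then show ?thesis
      using family_basis_mem_span_iff[of UNIV v I L k] mult \<open>L \<subseteq> I\<close> k
      by (simp add: multiplicative_basis_def arrow_def)
  qed
  then show "Y = V.span (v ` L) \<and> arrow_closed v I L"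
    using Y by (auto simp: multiplicative_basis_def family_basis_def arrow_closed_def)
next
  assume Y: "Y = V.span (v ` L) \<and> arrow_closed v I L"
  have "v i \<cdot> w j = 0 \<or> (\<exists>k\<in>L. v i \<cdot> w j \<noteq> 0 \<and> v i \<cdot> w j \<in> line (v k))"
    if ij: "i \<in> L" "j \<in> J" for i j
  proof (cases "v i \<cdot> w j = 0")
    case False
    then obtain k where "k \<in> I" "v i \<cdot> w j \<in> line (v k)"
      using mult ij \<open>L \<subseteq> I\<close> unfolding multiplicative_basis_def by blast
    moreover from this have "arrow v I i k"
      using False ij \<open>L \<subseteq> I\<close> by (auto simp: arrow_def)
    ultimately show ?thesis
      using Y ij False by (auto simp: arrow_closed_def)
  qed simp
  then show "multiplicative_basis Y v L"
    using Y mult \<open>L \<subseteq> I\<close> family_basis_subfamily by (auto simp: multiplicative_basis_def)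
qed

lemma submodule_of_multiplicative_basis:
  assumes "multiplicative_basis Y v L"
  shows "submodule Y"
proof -
  have "v i \<cdot> w j \<in> V.span (v ` L)" if ij: "i \<in> L" "j \<in> J" for i j
  proof (cases "v i \<cdot> w j = 0")
    case True
    then show ?thesis by (simp add: V.span_zero)
  next
    case False
    then obtain k where "k \<in> L" "v i \<cdot> w j \<in> line (v k)"
      using assms ij unfolding multiplicative_basis_def by blast
    then show ?thesis
      using line_subset_span V.span_base by blast
  qed
  then have "submodule (V.span (v ` L))"
    by (intro submodule_span) auto
  then show ?thesis
    using assms by (simp add: multiplicative_basis_def family_basis_def)
qed

text \<open>
  The \<open>\<star>\<close>-condition makes \<open>v i\<close> a single product \<open>v k \<cdot> x\<close>, but with \<open>x\<close> an arbitrary element of \<open>W\<close> rather than a basis element.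
  Expanding \<open>x\<close> in the basis \<open>w\<close> puts \<open>v i\<close> in the span of the \<open>v l\<close> with an arrow from \<open>k\<close> to
  \<open>l\<close>, and independence makes \<open>i\<close> itself one of these \<open>l\<close>.
\<close>

lemma arrow_sym:
  assumes star: "star_multiplicative_basis UNIV v I" and "arrow v I i k"
  shows "arrow v I k i"
proof -
  have mult: "multiplicative_basis UNIV v I"
    using star by (simp add: star_multiplicative_basis_def)
  obtain j where ik: "i \<in> I" "k \<in> I" and j: "j \<in> J" "v i \<cdot> w j \<noteq> 0" "v i \<cdot> w j \<in> line (v k)"
    using assms(2) by (auto simp: arrow_def)
  \<comment> \<open>The barred symbol of \<open>j\<close> reads the arrow backwards.\<close>
  have "i \<in> star v I k (Inr j)"
    using ik j by simp
  then obtain x where x: "v i = v k \<cdot> x"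
    using star ik j(1) unfolding star_multiplicative_basis_def by blast
  let ?N = "{l. arrow v I k l}"
  have "v k \<cdot> w j' \<in> V.span (v ` ?N)" if j': "j' \<in> J" for j'
  proof (cases "v k \<cdot> w j' = 0")
    case True
    then show ?thesis by (simp add: V.span_zero)
  next
    case False
    then obtain l where l: "l \<in> I" "v k \<cdot> w j' \<in> line (v l)"
      using mult ik j' unfolding multiplicative_basis_def by blast
    then have "v l \<in> v ` ?N"
      using False ik j' by (auto simp: arrow_def)
    then show ?thesis
      by (rule subsetD[OF line_subset_span[OF V.span_base] l(2)])
  qed
  then have "V.span ((\<lambda>j'. v k \<cdot> w j') ` J) \<subseteq> V.span (v ` ?N)"
    by (intro V.span_minimal) auto
  then have "v i \<in> V.span (v ` ?N)"
    using x act_mem_span_basis_products by auto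
  then show ?thesis
    using family_basis_mem_span_iff[of UNIV v I ?N i] mult ik
    by (auto simp: multiplicative_basis_def arrow_def)
qed

text \<open>
  Components are defined by directed reachability; reversibility of the arrows turns them into the
  classes of an equivalence relation.
\<close>

lemma component_eq:
  assumes "star_multiplicative_basis UNIV v I" "k \<in> component v I i"
  shows "component v I k = component v I i"
proof -
  have "symp (arrow v I)\<^sup>*\<^sup>*"
    using arrow_sym[OF assms(1)] by (intro symp_rtranclp sympI)
  then have "i \<in> component v I k"
    using assms(2) by (auto simp: component_def dest: sympD)
  then show ?thesis
    using assms(2) component_subset_arrow_closed[OF arrow_closed_component] by (intro equalityI)
qed

section \<open>Minimal submodules\<close>

lemma multiplicative_basis_component:
  assumes "multiplicative_basis UNIV v I" "i \<in> I"
  shows "multiplicative_basis (V.span (v ` component v I i)) v (component v I i)"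
  unfolding multiplicative_basis_subfamily_iff[OF assms(1) component_subset[OF assms(2)]]
  by (simp add: arrow_closed_component)

text \<open>
  A minimal \<open>Y\<close> has a nonempty arrow-closed index set \<open>K\<close>. The component of any \<open>i \<in> K\<close> lies in
  \<open>K\<close> and spans a nonzero submodule with inherited basis, so minimality makes this span all of
  \<open>Y\<close>. Conversely, a nonzero inherited submodule of the span of a component is given by a nonempty
  arrow-closed subset of it, which contains the component of one of its points; since components
  are equivalence classes, that is the whole component.
\<close>

lemma minimal_submodules_eq_component_spans:
  assumes star: "star_multiplicative_basis UNIV v I"
  shows "minimal_submodules v I = (\<lambda>i. V.span (v ` component v I i)) ` I"
proof -
  have mult: "multiplicative_basis UNIV v I"
    using star by (simp add: star_multiplicative_basis_def)
  then have nonzero: "v i \<noteq> 0" if "i \<in> I" for i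
    using that V.dependent_zero by (force simp: multiplicative_basis_def family_basis_def)
  have span_nonzero: "V.span (v ` L) \<noteq> {0}" if "i \<in> L" "i \<in> I" for i L
    using that nonzero[of i] V.span_base[of "v i" "v ` L"] by auto
  show ?thesis
  proof (intro equalityI subsetI)
    fix Y assume "Y \<in> minimal_submodules v I"
    then obtain K where K: "K \<subseteq> I" "multiplicative_basis Y v K"
      and min: "\<And>Z. Z \<subseteq> Y \<and> submodule Z \<and> Z \<noteq> {0} \<and> inherits_multiplicative_basis Z v K \<longleftrightarrow> Z = Y"
      unfolding minimal_submodules_def minimal_module_def by blast
    have Y: "Y = V.span (v ` K)" and closed: "arrow_closed v I K"
      using K multiplicative_basis_subfamily_iff[OF mult] by auto
    have "Y \<noteq> {0}" using min[of Y] by blast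
    then have "K \<noteq> {}" using Y by auto
    then obtain i where i: "i \<in> K" by blast
    then have "i \<in> I" using K by blast
    let ?C = "component v I i"
    have "?C \<subseteq> K"
      using component_subset_arrow_closed[OF closed i] .
    then have "inherits_multiplicative_basis (V.span (v ` ?C)) v K"
      using multiplicative_basis_component[OF mult \<open>i \<in> I\<close>]
      by (auto simp: inherits_multiplicative_basis_def)
    moreover have "V.span (v ` ?C) \<subseteq> Y"
      unfolding Y using \<open>?C \<subseteq> K\<close> by (intro V.span_mono image_mono)
    moreover have "submodule (V.span (v ` ?C))"
      using submodule_of_multiplicative_basis[OF multiplicative_basis_component[OF mult \<open>i \<in> I\<close>]] .
    ultimately have "V.span (v ` ?C) = Y"
      using min[of "V.span (v ` ?C)"] span_nonzero[OF component_self \<open>i \<in> I\<close>] by blast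
    then show "Y \<in> (\<lambda>i. V.span (v ` component v I i)) ` I"
      using \<open>i \<in> I\<close> by blast
  next
    fix Y assume "Y \<in> (\<lambda>i. V.span (v ` component v I i)) ` I"
    then obtain i where i: "i \<in> I" and Y: "Y = V.span (v ` component v I i)" by blast
    let ?C = "component v I i"
    have C: "?C \<subseteq> I" using component_subset[OF i] .
    have multC: "multiplicative_basis Y v ?C"
      unfolding Y using multiplicative_basis_component[OF mult i] .
    have sub: "submodule Y"
      using submodule_of_multiplicative_basis[OF multC] .
    have "Z = Y" if Z0: "Z \<noteq> {0}" and inh: "inherits_multiplicative_basis Z v ?C" for Z
    proof -
      obtain L where L: "L \<subseteq> ?C" "multiplicative_basis Z v L"
        using inh by (auto simp: inherits_multiplicative_basis_def)
      then have Z: "Z = V.span (v ` L)" and closed: "arrow_closed v I L"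
        using C multiplicative_basis_subfamily_iff[OF mult, of L] by auto
      have "L \<noteq> {}" using Z0 Z by auto
      then obtain k where k: "k \<in> L" by blast
      then have "component v I k = ?C"
        using component_eq[OF star] L(1) by blast
      then have "L = ?C"
        using component_subset_arrow_closed[OF closed k] L(1) by blast
      then show ?thesis using Z Y by simp
    qed
    moreover have "Y \<noteq> {0}"
      unfolding Y using span_nonzero[OF component_self i] .
    moreover have "inherits_multiplicative_basis Y v ?C"
      using multC by (auto simp: inherits_multiplicative_basis_def)
    ultimately have "minimal_module Y v ?C"
      using multC sub unfolding minimal_module_def by blast
    then show "Y \<in> minimal_submodules v I"
      using sub C multC unfolding minimal_submodules_def by blast
  qed
qed

lemma direct_sum_of_minimal_submodules:
  assumes star: "star_multiplicative_basis UNIV v I"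
  shows "V.direct_sum_of (minimal_submodules v I)"
proof (rule V.direct_sum_of_basis_blocks)
  have basis: "family_basis UNIV v I"
    using star by (simp add: star_multiplicative_basis_def multiplicative_basis_def)
  then show "V.independent (v ` I)" "V.span (v ` I) = UNIV"
    by (auto simp: family_basis_def)
  have mem: "v k \<in> V.span (v ` component v I i) \<longleftrightarrow> k \<in> component v I i"
    if "i \<in> I" "k \<in> I" for i k
    using family_basis_mem_span_iff[OF basis component_subset] that by blast
  fix Y assume "Y \<in> minimal_submodules v I"
  then obtain i where i: "i \<in> I" and Y: "Y = V.span (v ` component v I i)"
    unfolding minimal_submodules_eq_component_spans[OF star] by blast
  have "v ` I \<inter> Y = v ` component v I i"
    using mem[OF i] component_subset[OF i, of v] Y by auto
  then show "V.span (v ` I \<inter> Y) = Y"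
    using Y by simp
next
  have basis: "family_basis UNIV v I"
    using star by (simp add: star_multiplicative_basis_def multiplicative_basis_def)
  fix b assume "b \<in> v ` I"
  then obtain k where k: "k \<in> I" "b = v k" by blast
  show "\<exists>!Y. Y \<in> minimal_submodules v I \<and> b \<in> Y"
  proof (rule ex1I)
    show "V.span (v ` component v I k) \<in> minimal_submodules v I \<and> b \<in> V.span (v ` component v I k)"
      using k component_self[of k v I]
      unfolding minimal_submodules_eq_component_spans[OF star] by (blast intro: V.span_base)
  next
    fix Y assume "Y \<in> minimal_submodules v I \<and> b \<in> Y"
    then obtain i where i: "i \<in> I" "Y = V.span (v ` component v I i)" "v k \<in> Y"
      using k unfolding minimal_submodules_eq_component_spans[OF star] by blast
    then have "k \<in> component v I i"
      using family_basis_mem_span_iff[OF basis component_subset[OF i(1)] k(1)] by simp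
    then show "Y = V.span (v ` component v I k)"
      using component_eq[OF star] i(2) by simp
  qed
qed

text \<open>
  The \<open>\<star>\<close>-condition survives passing to a smaller index set, because shrinking \<open>I\<close> only shrinks the
  sets \<open>star v I a j\<close>.
\<close>

lemma star_multiplicative_basis_subfamily:
  assumes "star_multiplicative_basis UNIV v I" "K \<subseteq> I" "multiplicative_basis Y v K"
  shows "star_multiplicative_basis Y v K"
proof -
  have "b \<in> star v I a j" if "b \<in> star v K a j" for a b j
    using that \<open>K \<subseteq> I\<close> by (cases j) (auto split: if_splits)
  then show ?thesis
    using assms unfolding star_multiplicative_basis_def by blast
qed

lemma minimal_submodule_inherits_star_multiplicative_basis:
  assumes "star_multiplicative_basis UNIV v I" "Y \<in> minimal_submodules v I"
  shows "inherits_star_multiplicative_basis Y v I"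
proof -
  obtain K where "K \<subseteq> I" "multiplicative_basis Y v K"
    using assms(2) unfolding minimal_submodules_def by blast
  then show ?thesis
    using star_multiplicative_basis_subfamily[OF assms(1)]
    unfolding inherits_star_multiplicative_basis_def by blast
qed

end

theorem theorem3:
  fixes scaleV :: "'f::field \<Rightarrow> 'v::ab_group_add \<Rightarrow> 'v"
    and scaleW :: "'f \<Rightarrow> 'w::ab_group_add \<Rightarrow> 'w"
    and act :: "'v \<Rightarrow> 'w \<Rightarrow> 'v"
    and w :: "'j \<Rightarrow> 'w" and J :: "'j set"
    and v :: "'i \<Rightarrow> 'v" and I :: "'i set"
  assumes "based_module scaleV scaleW act w J"
    and "based_module.star_multiplicative_basis scaleV act w J UNIV v I"
  shows "vector_space.direct_sum_of scaleV
           (based_module.minimal_submodules scaleV act w J v I) \<and>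
         (\<forall>Y \<in> based_module.minimal_submodules scaleV act w J v I.
            based_module.inherits_star_multiplicative_basis scaleV act w J Y v I)"
proof -
  interpret based_module scaleV scaleW act w J
    by (rule assms(1))
  show ?thesis
    using direct_sum_of_minimal_submodules minimal_submodule_inherits_star_multiplicative_basis
      assms(2) by blast
qed

end
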